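(* Let $\mathcal A$ be a Boolean algebra and let $(x_\alpha)$ be a net in $\mathcal A$. Put $$A_0=\{a\in\mathcal A : \exists\alpha_0\ \forall\alpha\geqslant\alpha_0\ \ a\leqslant x_\alpha\},\qquad B_0=\{b\in\mathcal A : \exists\alpha_0\ \forall\alpha\geqslant\alpha_0\ \ b\geqslant x_\alpha\}.$$ The following are equivalent: (i) $(x_\alpha)$ is order Cauchy; (ii) for every $u>0$ there exist $v$ with $0<v\leqslant u$ and an index $\alpha_0$ such that $x_\alpha\wedge v=x_\beta\wedge v$ for all $\alpha,\beta\geqslant\alpha_0$; (iii) for every $u>0$, either there exist $v$ with $0<v\leqslant u$ and an index $\alpha_0$ such that $v\leqslant x_\alpha$ for all $\alpha\geqslant\alpha_0$, or there exist $v$ with $0<v\leqslant u$ and an index $\alpha_0$ such that $v\leqslant\bar x_\alpha$ for all $\alpha\geqslant\alpha_0$; (iv) $\sup(A_0\cup\overline{B_0})=1$; (v) there exist non-empty sets $A,B\subseteq\mathcal A$ such that $\sup(A\cup\overline{B})=1$ and for every $a\in A$ and $b\in B$ there exists $\alpha_0$ with $a\leqslant x_\alpha\leqslant b$ for all $\alpha\geqslant\alpha_0$.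
   Context: In a Boolean algebra, $\bar a$ denotes the complement of $a$, $|a-b|=(a\wedge\bar b)\vee(b\wedge\bar a)$ is the symmetric difference, and for a set $B$, $\overline{B}=\{\bar b : b\in B\}$. In a partially ordered set, a net $(x_\alpha)$ converges in order to $x$ if there exist non-empty sets $A$ and $B$ such that $\sup A=x=\inf B$ and for every $a\in A$ and $b\in B$ there is $\alpha_0$ with $a\leqslant x_\alpha\leqslant b$ for all $\alpha\geqslant\alpha_0$. A net $(x_\alpha)_{\alpha\in\Lambda}$ in a Boolean algebra is order Cauchy if the double net $(|x_\alpha-x_\beta|)$, indexed by $(\alpha,\beta)\in\Lambda^2$ with the coordinatewise order, converges in order to $0$. *)

theory Defs
  imports Main "HOL-Library.Lub_Glb" "HOL-Library.Product_Order"
begin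

text \<open>
  A net is a function on a preordered index type; that the index type is directed is an assumption
  of the statements about nets.  Suprema and infima are expressed by the relations
  \<^const>\<open>isLub\<close> and \<^const>\<open>isGlb\<close> on \<^const>\<open>UNIV\<close>, since they need not exist in general.
\<close>

definition directed_index :: "'i::preorder itself \<Rightarrow> bool" where
  "directed_index _ \<longleftrightarrow> (\<forall>\<alpha> \<beta> :: 'i. \<exists>\<gamma>. \<alpha> \<le> \<gamma> \<and> \<beta> \<le> \<gamma>)"

definition order_converges :: "('i::preorder \<Rightarrow> 'a::order) \<Rightarrow> 'a \<Rightarrow> bool" where
  "order_converges x l \<longleftrightarrow>
     (\<exists>A B. A \<noteq> {} \<and> B \<noteq> {} \<and> isLub UNIV A l \<and> isGlb UNIV B l \<and>
        (\<forall>a\<in>A. \<forall>b\<in>B. \<exists>\<alpha>\<^sub>0. \<forall>\<alpha>\<ge>\<alpha>\<^sub>0. a \<le> x \<alpha> \<and> x \<alpha> \<le> b))"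

definition symm_diff :: "'a::boolean_algebra \<Rightarrow> 'a \<Rightarrow> 'a" where
  "symm_diff a b = sup (inf a (- b)) (inf b (- a))"

text \<open>The order on pairs of indices is the coordinatewise one of \<^theory>\<open>HOL-Library.Product_Order\<close>.\<close>

definition order_cauchy :: "('i::preorder \<Rightarrow> 'a::boolean_algebra) \<Rightarrow> bool" where
  "order_cauchy x \<longleftrightarrow>
     order_converges (\<lambda>p :: 'i \<times> 'i. symm_diff (x (fst p)) (x (snd p))) bot"

end

theory Submission
  imports Defs
begin

text \<open>
  Whether a supremum is \<open>1\<close>, or an infimum \<open>0\<close>, can be tested below arbitrary
  non-zero elements: \<open>sup S = 1\<close> says that no \<open>u > 0\<close> is disjoint from every
  member of \<open>S\<close>, and \<open>inf B = 0\<close> says that no \<open>u > 0\<close> lies below every member of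
  \<open>B\<close> (\<open>isLub_top_iff\<close>, \<open>isGlb_bot_iff\<close>).  These tests turn the global conditions
  into the local ones.

  For (i), the elements \<open>v\<close> disjoint from \<open>|x\<^sub>\<alpha> - x\<^sub>\<beta>|\<close> are exactly those below which
  \<open>x\<^sub>\<alpha>\<close> and \<open>x\<^sub>\<beta>\<close> agree (\<open>le_compl_symm_diff_iff\<close>).  An eventual upper bound \<open>b\<close> of
  the double net is therefore the complement of an element below which the net is
  eventually constant; if \<open>u\<close> is not below \<open>b\<close>, then \<open>v = u \<sqinter> - b\<close> is the element
  required by (ii).  Conversely, (ii) supplies enough complements \<open>- v\<close> to force the
  infimum of all eventual upper bounds down to \<open>0\<close>.

  For (ii) and (iii), suppose that the net has a constant trace \<open>w\<close> below \<open>v\<close>: if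
  \<open>w > 0\<close>, then \<open>w\<close> is eventually below the net, and if \<open>w = 0\<close>, then \<open>v\<close> is
  eventually below the complements.

  The elements eventually below the net, and those eventually below its complements,
  form the down-closed sets \<open>A\<^sub>0\<close> and \<open>uminus ` B\<^sub>0\<close>.  For a down-closed set, meeting \<open>u\<close>
  is the same as containing a non-zero element below \<open>u\<close>, so (iii) is (iv).
  Finally, \<open>A\<^sub>0\<close> and \<open>B\<^sub>0\<close> are the largest sets admissible in (v).
\<close>

section \<open>Suprema and infima tested below non-zero elements\<close>

text \<open>An upper bound \<open>c\<close> of \<open>S\<close> other than \<open>top\<close> is the same thing as a non-zero element
  \<open>- c\<close> disjoint from all of \<open>S\<close>.\<close>

lemma isLub_top_iff:
  fixes S :: "'a::boolean_algebra set"
  shows "isLub UNIV S top \<longleftrightarrow> (\<forall>u>bot. \<exists>s\<in>S. inf s u \<noteq> bot)"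
proof -
  have "isLub UNIV S top \<longleftrightarrow> (\<forall>c. (\<forall>s\<in>S. s \<le> c) \<longrightarrow> c = top)"
    by (auto simp: isLub_def leastP_def setge_def isUb_def setle_def top_unique)
  also have "\<dots> \<longleftrightarrow> (\<forall>u. (\<forall>s\<in>S. inf s u = bot) \<longrightarrow> u = bot)"
    by (metis inf_shunt double_compl compl_bot_eq compl_top_eq)
  finally show ?thesis
    unfolding bot_less[symmetric] by blast
qed

lemma isGlb_bot_iff:
  fixes B :: "'a::boolean_algebra set"
  shows "isGlb UNIV B bot \<longleftrightarrow> (\<forall>u>bot. \<exists>b\<in>B. \<not> u \<le> b)"
  unfolding isGlb_def greatestP_def setle_def isLb_def setge_def bot_less[symmetric]
  by (auto simp: bot_unique)

text \<open>In a down-closed set, the meet of \<open>u\<close> with a member is again a member.\<close>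

lemma isLub_top_iff_down_closed:
  fixes S :: "'a::boolean_algebra set"
  assumes "\<And>s t. s \<in> S \<Longrightarrow> t \<le> s \<Longrightarrow> t \<in> S"
  shows "isLub UNIV S top \<longleftrightarrow> (\<forall>u>bot. \<exists>v\<in>S. bot < v \<and> v \<le> u)"
proof -
  have "(\<exists>s\<in>S. inf s u \<noteq> bot) \<longleftrightarrow> (\<exists>v\<in>S. bot < v \<and> v \<le> u)" for u
  proof
    assume "\<exists>s\<in>S. inf s u \<noteq> bot"
    then obtain s where "s \<in> S" "inf s u \<noteq> bot" by blast
    then have "inf s u \<in> S \<and> bot < inf s u \<and> inf s u \<le> u"
      using assms[of s "inf s u"] by (simp add: bot_less)
    then show "\<exists>v\<in>S. bot < v \<and> v \<le> u" by blast
  next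
    assume "\<exists>v\<in>S. bot < v \<and> v \<le> u"
    then show "\<exists>s\<in>S. inf s u \<noteq> bot"
      by (metis inf.absorb1 less_irrefl)
  qed
  then show ?thesis
    by (simp add: isLub_top_iff)
qed

section \<open>Order Cauchy nets\<close>

lemma le_compl_symm_diff_iff:
  fixes a b v :: "'a::boolean_algebra"
  shows "v \<le> - symm_diff a b \<longleftrightarrow> inf a v = inf b v"
proof -
  have "v \<le> - symm_diff a b \<longleftrightarrow> inf v (sup (inf a (- b)) (inf b (- a))) = bot"
    by (simp add: symm_diff_def inf_shunt)
  also have "\<dots> \<longleftrightarrow> inf (inf a v) (- b) = bot \<and> inf (inf b v) (- a) = bot"
    by (simp add: inf_sup_distrib1 ac_simps)
  also have "\<dots> \<longleftrightarrow> inf a v \<le> b \<and> inf b v \<le> a"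
    by (simp add: inf_shunt)
  also have "\<dots> \<longleftrightarrow> inf a v = inf b v"
    by (simp add: order_eq_iff)
  finally show ?thesis .
qed

lemma directed_index_joint_tail:
  fixes P Q :: "'i::preorder \<Rightarrow> bool"
  assumes "directed_index TYPE('i)"
    and "\<exists>\<alpha>\<^sub>0. \<forall>\<alpha>\<ge>\<alpha>\<^sub>0. P \<alpha>" and "\<exists>\<alpha>\<^sub>0. \<forall>\<alpha>\<ge>\<alpha>\<^sub>0. Q \<alpha>"
  shows "\<exists>\<alpha>\<^sub>0. \<forall>\<alpha>\<ge>\<alpha>\<^sub>0. P \<alpha> \<and> Q \<alpha>"
  using assms unfolding directed_index_def by (meson order_trans)

text \<open>A tail of the index set \<open>\<Lambda>\<^sup>2\<close> is a product of two tails of \<open>\<Lambda>\<close>; directedness lets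
  the two factors be chosen equal.  The lower set in the definition of order convergence
  to \<open>bot\<close> can be taken to be \<open>{bot}\<close>, and the upper set to consist of all eventual upper
  bounds.\<close>

lemma order_cauchy_iff:
  fixes x :: "'i::preorder \<Rightarrow> 'a::boolean_algebra"
  assumes dir: "directed_index TYPE('i)"
  shows "order_cauchy x \<longleftrightarrow>
    isGlb UNIV {b. \<exists>\<alpha>\<^sub>0. \<forall>\<alpha>\<ge>\<alpha>\<^sub>0. \<forall>\<beta>\<ge>\<alpha>\<^sub>0. symm_diff (x \<alpha>) (x \<beta>) \<le> b} bot"
    (is "_ \<longleftrightarrow> isGlb UNIV ?B bot")
proof
  assume "order_cauchy x"
  then obtain A B where "A \<noteq> {}" and glb: "isGlb UNIV B bot"
    and conv: "\<forall>a\<in>A. \<forall>b\<in>B. \<exists>p. \<forall>q\<ge>p.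
      a \<le> symm_diff (x (fst q)) (x (snd q)) \<and> symm_diff (x (fst q)) (x (snd q)) \<le> b"
    unfolding order_cauchy_def order_converges_def by blast
  have "B \<subseteq> ?B"
  proof
    fix b assume "b \<in> B"
    with \<open>A \<noteq> {}\<close> conv obtain p :: "'i \<times> 'i"
      where p: "\<forall>q\<ge>p. symm_diff (x (fst q)) (x (snd q)) \<le> b"
      by blast
    obtain \<gamma> where "fst p \<le> \<gamma>" "snd p \<le> \<gamma>"
      using dir unfolding directed_index_def by blast
    then have "symm_diff (x \<alpha>) (x \<beta>) \<le> b" if "\<alpha> \<ge> \<gamma>" "\<beta> \<ge> \<gamma>" for \<alpha> \<beta>
      using p[rule_format, of "(\<alpha>, \<beta>)"] that
      by (auto simp: less_eq_prod_def intro: order_trans)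
    then show "b \<in> ?B" by blast
  qed
  with glb show "isGlb UNIV ?B bot"
    unfolding isGlb_bot_iff by blast
next
  assume glb: "isGlb UNIV ?B bot"
  show "order_cauchy x"
    unfolding order_cauchy_def order_converges_def
  proof (rule exI[of _ "{bot}"], rule exI[of _ ?B], intro conjI ballI)
    have "top \<in> ?B" by simp
    then show "?B \<noteq> {}" by blast
    show "isLub UNIV {bot::'a} bot"
      by (simp add: isLub_def leastP_def setge_def isUb_def setle_def)
    show "isGlb UNIV ?B bot" by (fact glb)
  next
    fix a b :: 'a
    assume a: "a \<in> {bot}" and "b \<in> ?B"
    then obtain \<alpha>\<^sub>0 where "\<forall>\<alpha>\<ge>\<alpha>\<^sub>0. \<forall>\<beta>\<ge>\<alpha>\<^sub>0. symm_diff (x \<alpha>) (x \<beta>) \<le> b" by blast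
    with a have "\<forall>q\<ge>(\<alpha>\<^sub>0, \<alpha>\<^sub>0).
        a \<le> symm_diff (x (fst q)) (x (snd q)) \<and> symm_diff (x (fst q)) (x (snd q)) \<le> b"
      by (simp add: less_eq_prod_def)
    then show "\<exists>p. \<forall>q\<ge>p.
        a \<le> symm_diff (x (fst q)) (x (snd q)) \<and> symm_diff (x (fst q)) (x (snd q)) \<le> b"
      by blast
  qed simp
qed

lemma order_cauchy_iff_locally_constant:
  fixes x :: "'i::preorder \<Rightarrow> 'a::boolean_algebra"
  assumes dir: "directed_index TYPE('i)"
  shows "order_cauchy x \<longleftrightarrow> (\<forall>u>bot. \<exists>v. bot < v \<and> v \<le> u \<and>
    (\<exists>\<alpha>\<^sub>0. \<forall>\<alpha>\<ge>\<alpha>\<^sub>0. \<forall>\<beta>\<ge>\<alpha>\<^sub>0. inf (x \<alpha>) v = inf (x \<beta>) v))"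
proof -
  let ?C = "{v. \<exists>\<alpha>\<^sub>0. \<forall>\<alpha>\<ge>\<alpha>\<^sub>0. \<forall>\<beta>\<ge>\<alpha>\<^sub>0. v \<le> - symm_diff (x \<alpha>) (x \<beta>)}"
  let ?B = "{b. \<exists>\<alpha>\<^sub>0. \<forall>\<alpha>\<ge>\<alpha>\<^sub>0. \<forall>\<beta>\<ge>\<alpha>\<^sub>0. symm_diff (x \<alpha>) (x \<beta>) \<le> b}"
  have compl: "- b \<in> ?C \<longleftrightarrow> b \<in> ?B" for b by simp
  have "(\<exists>b\<in>?B. \<not> u \<le> b) \<longleftrightarrow> (\<exists>v\<in>?C. bot < v \<and> v \<le> u)" for u
  proof
    assume "\<exists>b\<in>?B. \<not> u \<le> b"
    then obtain b where b: "b \<in> ?B" "\<not> u \<le> b" by blast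
    have "inf u (- b) \<in> ?C"
      using compl[of b] b(1) by (blast intro: le_infI2)
    moreover have "inf u (- b) \<noteq> bot"
      using b(2) by (simp add: inf_shunt)
    then have "bot < inf u (- b)"
      by (simp only: bot_less)
    ultimately show "\<exists>v\<in>?C. bot < v \<and> v \<le> u" by (meson inf_le1)
  next
    assume "\<exists>v\<in>?C. bot < v \<and> v \<le> u"
    then obtain v where v: "v \<in> ?C" "bot < v" "v \<le> u" by blast
    have "- v \<in> ?B" using compl[of "- v"] v(1) by simp
    moreover have "\<not> u \<le> - v"
    proof
      assume "u \<le> - v"
      with v(3) have "v \<le> - v" by (rule order_trans)
      then have "inf v v = bot" by (simp only: inf_shunt)
      with v(2) show False by simp
    qed
    ultimately show "\<exists>b\<in>?B. \<not> u \<le> b" by blast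
  qed
  then have "order_cauchy x \<longleftrightarrow> (\<forall>u>bot. \<exists>v\<in>?C. bot < v \<and> v \<le> u)"
    unfolding order_cauchy_iff[OF dir] isGlb_bot_iff by blast
  then show ?thesis
    unfolding le_compl_symm_diff_iff by blast
qed

section \<open>Deciding the net below small elements\<close>

text \<open>The constant trace \<open>w\<close> of the net below \<open>v\<close> decides between the two alternatives:
  a non-zero \<open>w\<close> is itself below the net, while \<open>w = bot\<close> makes \<open>v\<close> disjoint from the
  net.\<close>

lemma locally_constant_iff_locally_decided:
  fixes x :: "'i::preorder \<Rightarrow> 'a::boolean_algebra"
  shows "(\<exists>v. bot < v \<and> v \<le> u \<and>
      (\<exists>\<alpha>\<^sub>0. \<forall>\<alpha>\<ge>\<alpha>\<^sub>0. \<forall>\<beta>\<ge>\<alpha>\<^sub>0. inf (x \<alpha>) v = inf (x \<beta>) v)) \<longleftrightarrow>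
    (\<exists>v. bot < v \<and> v \<le> u \<and> (\<exists>\<alpha>\<^sub>0. \<forall>\<alpha>\<ge>\<alpha>\<^sub>0. v \<le> x \<alpha>)) \<or>
    (\<exists>v. bot < v \<and> v \<le> u \<and> (\<exists>\<alpha>\<^sub>0. \<forall>\<alpha>\<ge>\<alpha>\<^sub>0. v \<le> - x \<alpha>))"
    (is "?const \<longleftrightarrow> ?below \<or> ?disjoint")
proof
  assume ?const
  then obtain v \<alpha>\<^sub>0 where v: "bot < v" "v \<le> u"
    and const: "\<forall>\<alpha>\<ge>\<alpha>\<^sub>0. \<forall>\<beta>\<ge>\<alpha>\<^sub>0. inf (x \<alpha>) v = inf (x \<beta>) v" by blast
  define w where "w = inf (x \<alpha>\<^sub>0) v"
  have w: "inf (x \<alpha>) v = w" if "\<alpha> \<ge> \<alpha>\<^sub>0" for \<alpha>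
    using const that unfolding w_def by blast
  show "?below \<or> ?disjoint"
  proof (cases "w = bot")
    case True
    then have "\<forall>\<alpha>\<ge>\<alpha>\<^sub>0. v \<le> - x \<alpha>"
      using w by (metis inf.commute inf_shunt)
    with v show ?thesis by blast
  next
    case False
    then have "bot < w" by (simp add: bot_less)
    moreover have "w \<le> u" using v(2) unfolding w_def by (rule le_infI2)
    moreover have "\<forall>\<alpha>\<ge>\<alpha>\<^sub>0. w \<le> x \<alpha>" using w by (metis inf_le1)
    ultimately show ?thesis by blast
  qed
next
  assume "?below \<or> ?disjoint"
  then show ?const
  proof
    assume ?below
    then show ?const by (metis inf.absorb2)
  next
    assume ?disjoint
    then show ?const by (metis inf.commute inf_shunt)
  qed
qed

theorem corollary6p5:
  fixes x :: "'i::preorder \<Rightarrow> 'a::boolean_algebra"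
    and A\<^sub>0 B\<^sub>0 :: "'a set"
  assumes "directed_index TYPE('i)"
  defines "A\<^sub>0 \<equiv> {a. \<exists>\<alpha>\<^sub>0. \<forall>\<alpha>\<ge>\<alpha>\<^sub>0. a \<le> x \<alpha>}"
    and "B\<^sub>0 \<equiv> {b. \<exists>\<alpha>\<^sub>0. \<forall>\<alpha>\<ge>\<alpha>\<^sub>0. b \<ge> x \<alpha>}"
  shows
    "(order_cauchy x \<longleftrightarrow>
       (\<forall>u>bot. \<exists>v. bot < v \<and> v \<le> u \<and>
          (\<exists>\<alpha>\<^sub>0. \<forall>\<alpha>\<ge>\<alpha>\<^sub>0. \<forall>\<beta>\<ge>\<alpha>\<^sub>0. inf (x \<alpha>) v = inf (x \<beta>) v))) \<and>
     (order_cauchy x \<longleftrightarrow>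
       (\<forall>u>bot.
          (\<exists>v. bot < v \<and> v \<le> u \<and> (\<exists>\<alpha>\<^sub>0. \<forall>\<alpha>\<ge>\<alpha>\<^sub>0. v \<le> x \<alpha>)) \<or>
          (\<exists>v. bot < v \<and> v \<le> u \<and> (\<exists>\<alpha>\<^sub>0. \<forall>\<alpha>\<ge>\<alpha>\<^sub>0. v \<le> - x \<alpha>)))) \<and>
     (order_cauchy x \<longleftrightarrow> isLub UNIV (A\<^sub>0 \<union> uminus ` B\<^sub>0) top) \<and>
     (order_cauchy x \<longleftrightarrow>
       (\<exists>A B. A \<noteq> {} \<and> B \<noteq> {} \<and> isLub UNIV (A \<union> uminus ` B) top \<and>
          (\<forall>a\<in>A. \<forall>b\<in>B. \<exists>\<alpha>\<^sub>0. \<forall>\<alpha>\<ge>\<alpha>\<^sub>0. a \<le> x \<alpha> \<and> x \<alpha> \<le> b)))"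
proof -
  have mem_compl: "v \<in> uminus ` B\<^sub>0 \<longleftrightarrow> (\<exists>\<alpha>\<^sub>0. \<forall>\<alpha>\<ge>\<alpha>\<^sub>0. v \<le> - x \<alpha>)" for v
  proof -
    have "v \<in> uminus ` B\<^sub>0 \<longleftrightarrow> - v \<in> B\<^sub>0"
      by (metis double_compl image_iff)
    then show ?thesis
      unfolding B\<^sub>0_def mem_Collect_eq by (meson compl_le_swap1)
  qed
  have down_closed: "t \<in> A\<^sub>0 \<union> uminus ` B\<^sub>0" if "s \<in> A\<^sub>0 \<union> uminus ` B\<^sub>0" "t \<le> s" for s t
    using that unfolding Un_iff mem_compl A\<^sub>0_def mem_Collect_eq by (meson order_trans)
  have decided: "(\<exists>v. bot < v \<and> v \<le> u \<and> (\<exists>\<alpha>\<^sub>0. \<forall>\<alpha>\<ge>\<alpha>\<^sub>0. v \<le> x \<alpha>)) \<or>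
      (\<exists>v. bot < v \<and> v \<le> u \<and> (\<exists>\<alpha>\<^sub>0. \<forall>\<alpha>\<ge>\<alpha>\<^sub>0. v \<le> - x \<alpha>)) \<longleftrightarrow>
    (\<exists>v\<in>A\<^sub>0 \<union> uminus ` B\<^sub>0. bot < v \<and> v \<le> u)" for u
    unfolding Bex_def Un_iff mem_compl A\<^sub>0_def mem_Collect_eq by blast
  note i_ii = order_cauchy_iff_locally_constant[OF assms(1), of x]
  note i_iii = i_ii[unfolded locally_constant_iff_locally_decided]
  have i_iv: "order_cauchy x \<longleftrightarrow> isLub UNIV (A\<^sub>0 \<union> uminus ` B\<^sub>0) top"
    unfolding i_iii[unfolded decided]
    by (rule isLub_top_iff_down_closed[symmetric]) (rule down_closed)
  have iv_v: "isLub UNIV (A\<^sub>0 \<union> uminus ` B\<^sub>0) top \<longleftrightarrow>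
    (\<exists>A B. A \<noteq> {} \<and> B \<noteq> {} \<and> isLub UNIV (A \<union> uminus ` B) top \<and>
      (\<forall>a\<in>A. \<forall>b\<in>B. \<exists>\<alpha>\<^sub>0. \<forall>\<alpha>\<ge>\<alpha>\<^sub>0. a \<le> x \<alpha> \<and> x \<alpha> \<le> b))" (is "_ \<longleftrightarrow> ?v")
  proof
    assume lub: "isLub UNIV (A\<^sub>0 \<union> uminus ` B\<^sub>0) top"
    have "bot \<in> A\<^sub>0" "top \<in> B\<^sub>0"
      by (simp_all add: A\<^sub>0_def B\<^sub>0_def)
    moreover have "\<exists>\<alpha>\<^sub>0. \<forall>\<alpha>\<ge>\<alpha>\<^sub>0. a \<le> x \<alpha> \<and> x \<alpha> \<le> b" if "a \<in> A\<^sub>0" "b \<in> B\<^sub>0" for a b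
      using that unfolding A\<^sub>0_def B\<^sub>0_def mem_Collect_eq
      by (rule directed_index_joint_tail[OF assms(1)])
    ultimately show ?v
      using lub by (intro exI[of _ A\<^sub>0] exI[of _ B\<^sub>0] conjI ballI) auto
  next
    assume ?v
    then obtain A B where AB: "A \<noteq> {}" "B \<noteq> {}" "isLub UNIV (A \<union> uminus ` B) top"
      and between: "\<forall>a\<in>A. \<forall>b\<in>B. \<exists>\<alpha>\<^sub>0. \<forall>\<alpha>\<ge>\<alpha>\<^sub>0. a \<le> x \<alpha> \<and> x \<alpha> \<le> b" by blast
    \<comment> \<open>Membership of \<open>a\<close> in \<open>A\<^sub>0\<close> comes from pairing it with some \<open>b \<in> B\<close>, and vice
      versa; this is where the non-emptiness in (v) enters.\<close>
    have "a \<in> A\<^sub>0 \<and> b \<in> B\<^sub>0" if "a \<in> A" "b \<in> B" for a b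
      using between[rule_format, OF that] unfolding A\<^sub>0_def B\<^sub>0_def by blast
    with AB(1,2) have "A \<subseteq> A\<^sub>0" "B \<subseteq> B\<^sub>0" by blast+
    then have "A \<union> uminus ` B \<subseteq> A\<^sub>0 \<union> uminus ` B\<^sub>0" by blast
    with AB(3) show "isLub UNIV (A\<^sub>0 \<union> uminus ` B\<^sub>0) top"
      unfolding isLub_top_iff by blast
  qed
  show ?thesis
    by (intro conjI) (fact i_ii, fact i_iii, fact i_iv, fact i_iv[unfolded iv_v])
qed

end
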